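(* Let $\Lambda$ be an Artin algebra, let $(N\xrightarrow{g}M)$ be an object in $\mathcal{H}(\Lambda)$ and let $\delta:N\to Q_0$ be a left $\mathrm{prj}\text{-}\Lambda$-approximation of $N$. Let $U$ be the push-out of $\delta$ along $g$, with canonical maps $h:Q_0\to U$ and $\lambda:M\to U$ (so $h\delta=\lambda g$), and let $d:U\to Q$ be a left $\mathrm{prj}\text{-}\Lambda$-approximation. Then $$\left(\delta,\ d\lambda\right):\left(N\xrightarrow{g}M\right)\to\left(Q_0\xrightarrow{dh}Q\right)$$ is a left $\mathcal{P}(\Lambda)$-approximation.
   Context: $\mathrm{mod}\text{-}\Lambda$ is the category of finitely generated $\Lambda$-modules and $\mathrm{prj}\text{-}\Lambda$ its full subcategory of projective modules. $\mathcal{H}(\Lambda)$ is the morphism category of $\mathrm{mod}\text{-}\Lambda$: objects are morphisms $f:X\to Y$ in $\mathrm{mod}\text{-}\Lambda$, and a morphism from $(X\xrightarrow{f}Y)$ to $(X'\xrightarrow{f'}Y')$ is a pair $(\sigma_1,\sigma_2)$ with $\sigma_1:X\to X'$, $\sigma_2:Y\to Y'$ and $\sigma_2f=f'\sigma_1$. $\mathcal{P}(\Lambda)$ is the full subcategory of $\mathcal{H}(\Lambda)$ of objects $(P\xrightarrow{f}Q)$ with $P,Q$ projective. For a full subcategory $\mathcal{X}$, a left $\mathcal{X}$-approximation of an object $C$ is a morphism $C\to X$ with $X\in\mathcal{X}$ through which every morphism from $C$ to an object of $\mathcal{X}$ factors. *)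

theory Defs
  imports "HOL-Algebra.Module" "HOL-Algebra.Ideal"
begin

section \<open>Categories, approximations and push-outs\<close>

record ('o, 'f) cat =
  Ob :: "'o set"
  Hom :: "'o \<Rightarrow> 'o \<Rightarrow> 'f set"
  Id :: "'o \<Rightarrow> 'f"
  Comp :: "'o \<Rightarrow> 'o \<Rightarrow> 'o \<Rightarrow> 'f \<Rightarrow> 'f \<Rightarrow> 'f"
  \<comment> \<open>\<open>Comp C x y z g f\<close> is the composite of \<open>f : x \<rightarrow> y\<close> and \<open>g : y \<rightarrow> z\<close>.\<close>

locale category =
  fixes C :: "('o, 'f) cat"
  assumes Id_in: "x \<in> Ob C \<Longrightarrow> Id C x \<in> Hom C x x"
    and Comp_in:
      "\<lbrakk>x \<in> Ob C; y \<in> Ob C; z \<in> Ob C; f \<in> Hom C x y; g \<in> Hom C y z\<rbrakk>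
        \<Longrightarrow> Comp C x y z g f \<in> Hom C x z"
    and Id_left: "\<lbrakk>x \<in> Ob C; y \<in> Ob C; f \<in> Hom C x y\<rbrakk> \<Longrightarrow> Comp C x y y (Id C y) f = f"
    and Id_right: "\<lbrakk>x \<in> Ob C; y \<in> Ob C; f \<in> Hom C x y\<rbrakk> \<Longrightarrow> Comp C x x y f (Id C x) = f"
    and Comp_assoc:
      "\<lbrakk>w \<in> Ob C; x \<in> Ob C; y \<in> Ob C; z \<in> Ob C;
        f \<in> Hom C w x; g \<in> Hom C x y; h \<in> Hom C y z\<rbrakk>
        \<Longrightarrow> Comp C w x z (Comp C x y z h g) f = Comp C w y z h (Comp C w x y g f)"

text \<open>A full subcategory is given by its class \<open>X\<close> of objects.\<close>

definition left_approximation ::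
    "('o, 'f) cat \<Rightarrow> 'o set \<Rightarrow> 'o \<Rightarrow> 'o \<Rightarrow> 'f \<Rightarrow> bool" where
  "left_approximation C X c x f \<longleftrightarrow>
     X \<subseteq> Ob C \<and> c \<in> Ob C \<and> x \<in> X \<and> f \<in> Hom C c x \<and>
     (\<forall>x'\<in>X. \<forall>f'\<in>Hom C c x'. \<exists>t\<in>Hom C x x'. Comp C c x x' t f = f')"

text \<open>\<open>pushout C a b c u f g h l\<close>: the object \<open>u\<close> with \<open>h : b \<rightarrow> u\<close>, \<open>l : c \<rightarrow> u\<close> is a push-out of
  \<open>f : a \<rightarrow> b\<close> and \<open>g : a \<rightarrow> c\<close>.\<close>

definition pushout ::
    "('o, 'f) cat \<Rightarrow> 'o \<Rightarrow> 'o \<Rightarrow> 'o \<Rightarrow> 'o \<Rightarrow> 'f \<Rightarrow> 'f \<Rightarrow> 'f \<Rightarrow> 'f \<Rightarrow> bool" where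
  "pushout C a b c u f g h l \<longleftrightarrow>
     {a, b, c, u} \<subseteq> Ob C \<and>
     f \<in> Hom C a b \<and> g \<in> Hom C a c \<and> h \<in> Hom C b u \<and> l \<in> Hom C c u \<and>
     Comp C a b u h f = Comp C a c u l g \<and>
     (\<forall>w\<in>Ob C. \<forall>p\<in>Hom C b w. \<forall>q\<in>Hom C c w.
        Comp C a b w p f = Comp C a c w q g \<longrightarrow>
        (\<exists>!t. t \<in> Hom C u w \<and> Comp C b u w t h = p \<and> Comp C c u w t l = q))"

text \<open>The object \<open>f : X \<rightarrow> Y\<close> of the morphism category is the triple \<open>(X, Y, f)\<close>.\<close>

definition morphism_cat :: "('o, 'f) cat \<Rightarrow> ('o \<times> 'o \<times> 'f, 'f \<times> 'f) cat" where
  "morphism_cat C =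
     \<lparr>Ob = {(X, Y, f). X \<in> Ob C \<and> Y \<in> Ob C \<and> f \<in> Hom C X Y},
      Hom = (\<lambda>(X, Y, f) (X', Y', f').
        {(s1, s2). s1 \<in> Hom C X X' \<and> s2 \<in> Hom C Y Y' \<and>
           Comp C X Y Y' s2 f = Comp C X X' Y' f' s1}),
      Id = (\<lambda>(X, Y, f). (Id C X, Id C Y)),
      Comp = (\<lambda>(X, Y, f) (X', Y', f') (X'', Y'', f'') (t1, t2) (s1, s2).
        (Comp C X X' X'' t1 s1, Comp C Y Y' Y'' t2 s2))\<rparr>"

lemma category_morphism_cat:
  assumes "category C"
  shows "category (morphism_cat C)"
proof -
  interpret category C by fact
  show ?thesis
    by unfold_locales
      (auto simp: morphism_cat_def Id_in Id_left Id_right Comp_in Comp_assoc,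
       metis Comp_assoc)
qed


section \<open>Modules over a not necessarily commutative ring\<close>

text \<open>\<^locale>\<open>module\<close> requires a commutative ring of scalars. Its axioms over an arbitrary ring
  are those of a left module. Modules are left modules throughout; right modules are left modules
  over the opposite ring.\<close>

locale left_module = R?: ring R + M?: abelian_group M
  for R (structure) and M (structure) +
  assumes smult_closed [simp, intro]:
      "\<lbrakk>a \<in> carrier R; x \<in> carrier M\<rbrakk> \<Longrightarrow> a \<odot>\<^bsub>M\<^esub> x \<in> carrier M"
    and smult_l_distr:
      "\<lbrakk>a \<in> carrier R; b \<in> carrier R; x \<in> carrier M\<rbrakk>
        \<Longrightarrow> (a \<oplus> b) \<odot>\<^bsub>M\<^esub> x = a \<odot>\<^bsub>M\<^esub> x \<oplus>\<^bsub>M\<^esub> b \<odot>\<^bsub>M\<^esub> x"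
    and smult_r_distr:
      "\<lbrakk>a \<in> carrier R; x \<in> carrier M; y \<in> carrier M\<rbrakk>
        \<Longrightarrow> a \<odot>\<^bsub>M\<^esub> (x \<oplus>\<^bsub>M\<^esub> y) = a \<odot>\<^bsub>M\<^esub> x \<oplus>\<^bsub>M\<^esub> a \<odot>\<^bsub>M\<^esub> y"
    and smult_assoc:
      "\<lbrakk>a \<in> carrier R; b \<in> carrier R; x \<in> carrier M\<rbrakk>
        \<Longrightarrow> (a \<otimes> b) \<odot>\<^bsub>M\<^esub> x = a \<odot>\<^bsub>M\<^esub> (b \<odot>\<^bsub>M\<^esub> x)"
    and smult_one [simp]:
      "x \<in> carrier M \<Longrightarrow> \<one> \<odot>\<^bsub>M\<^esub> x = x"

definition finitely_generated :: "('a, 'b) ring_scheme \<Rightarrow> ('a, 'm, 'c) module_scheme \<Rightarrow> bool" where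
  "finitely_generated R M \<longleftrightarrow>
     (\<exists>S. finite S \<and> S \<subseteq> carrier M \<and>
        (\<forall>x\<in>carrier M. \<exists>c \<in> S \<rightarrow> carrier R. x = (\<Oplus>\<^bsub>M\<^esub>s\<in>S. c s \<odot>\<^bsub>M\<^esub> s)))"

text \<open>Homomorphisms are extensional functions, so that equality of functions is equality of
  morphisms.\<close>

definition module_homs ::
    "('a, 'b) ring_scheme \<Rightarrow> ('a, 'm, 'c) module_scheme \<Rightarrow> ('a, 'n, 'd) module_scheme \<Rightarrow> ('m \<Rightarrow> 'n) set"
  where
  "module_homs R M N =
     {f \<in> carrier M \<rightarrow>\<^sub>E carrier N.
        (\<forall>x\<in>carrier M. \<forall>y\<in>carrier M. f (x \<oplus>\<^bsub>M\<^esub> y) = f x \<oplus>\<^bsub>N\<^esub> f y) \<and>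
        (\<forall>a\<in>carrier R. \<forall>x\<in>carrier M. f (a \<odot>\<^bsub>M\<^esub> x) = a \<odot>\<^bsub>N\<^esub> f x)}"

text \<open>The category of finitely generated modules whose carrier is a set of elements of the type
  \<open>'m\<close>. For \<open>'m = nat \<Rightarrow> 'a\<close> (and for any larger type) every finitely generated module, over
  whatever carrier type, is isomorphic to an object of it: see \<open>finitely_generated_copy\<close> below.\<close>

definition mod_cat :: "('a, 'b) ring_scheme \<Rightarrow> (('a, 'm) module, 'm \<Rightarrow> 'm) cat" where
  "mod_cat R =
     \<lparr>Ob = {M. left_module R M \<and> finitely_generated R M},
      Hom = module_homs R,
      Id = (\<lambda>M. restrict id (carrier M)),
      Comp = (\<lambda>X Y Z g f. compose (carrier X) g f)\<rparr>"

lemma module_homs_compose: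
  assumes "f \<in> module_homs R M N" "g \<in> module_homs R N K" "left_module R M"
  shows "compose (carrier M) g f \<in> module_homs R M K"
proof -
  interpret left_module R M by fact
  show ?thesis
    using assms(1,2) by (auto simp: module_homs_def compose_def PiE_def Pi_def extensional_def)
qed

lemma category_mod_cat:
  fixes R :: "('a, 'b) ring_scheme"
  shows "category (mod_cat R :: (('a, 'm) module, 'm \<Rightarrow> 'm) cat)"
proof
  fix x y z :: "('a, 'm) module" and f g
  assume "x \<in> Ob (mod_cat R)" "f \<in> Hom (mod_cat R) x y" "g \<in> Hom (mod_cat R) y z"
  then show "Comp (mod_cat R) x y z g f \<in> Hom (mod_cat R) x z"
    by (simp add: mod_cat_def module_homs_compose)
next
  fix x :: "('a, 'm) module"
  assume "x \<in> Ob (mod_cat R)"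
  then interpret left_module R x by (simp add: mod_cat_def)
  show "Id (mod_cat R) x \<in> Hom (mod_cat R) x x"
    by (auto simp: mod_cat_def module_homs_def)
qed (auto simp: mod_cat_def module_homs_def compose_def PiE_def Pi_def extensional_def fun_eq_iff)

text \<open>Projectivity is the lifting property against epimorphisms of finitely generated modules.
  The test modules live on the type \<open>nat \<Rightarrow> 'a\<close> and not on that of \<open>P\<close>, so that the notion does not
  depend on the carrier type of \<open>P\<close>. By \<open>projective_module_lift\<close> below this choice of type is no
  restriction.\<close>

definition projective_module :: "('a, 'b) ring_scheme \<Rightarrow> ('a, 'm, 'c) module_scheme \<Rightarrow> bool" where
  "projective_module R P \<longleftrightarrow>
     left_module R P \<and>
     (\<forall>(B :: ('a, nat \<Rightarrow> 'a) module) \<in> Ob (mod_cat R).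
      \<forall>(C :: ('a, nat \<Rightarrow> 'a) module) \<in> Ob (mod_cat R).
      \<forall>p\<in>module_homs R B C. \<forall>f\<in>module_homs R P C.
        p ` carrier B = carrier C \<longrightarrow>
        (\<exists>t\<in>module_homs R P B. compose (carrier P) p t = f))"

definition prj :: "('a, 'b) ring_scheme \<Rightarrow> ('a, 'm) module set" where
  "prj R = {P \<in> Ob (mod_cat R). projective_module R P}"


subsection \<open>Independence of the carrier type\<close>

lemma finitely_generated_copy:
  fixes R :: "('a, 'b) ring_scheme" and M :: "('a, 'm, 'c) module_scheme"
  assumes M: "left_module R M" and fg: "finitely_generated R M"
  obtains M' :: "('a, nat \<Rightarrow> 'a) module" and i j where
    "M' \<in> Ob (mod_cat R)" "i \<in> module_homs R M M'" "j \<in> module_homs R M' M"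
    "\<And>x. x \<in> carrier M \<Longrightarrow> j (i x) = x" "\<And>y. y \<in> carrier M' \<Longrightarrow> i (j y) = y"
proof -
  interpret left_module R M by fact
  obtain S where S: "finite S" "S \<subseteq> carrier M"
    and gen: "\<forall>x\<in>carrier M. \<exists>c \<in> S \<rightarrow> carrier R. x = (\<Oplus>\<^bsub>M\<^esub>s\<in>S. c s \<odot>\<^bsub>M\<^esub> s)"
    using fg unfolding finitely_generated_def by blast
  obtain c where c: "\<And>x. x \<in> carrier M \<Longrightarrow> c x \<in> S \<rightarrow> carrier R"
    "\<And>x. x \<in> carrier M \<Longrightarrow> x = (\<Oplus>\<^bsub>M\<^esub>s\<in>S. c x s \<odot>\<^bsub>M\<^esub> s)"
    using gen by metis
  obtain v :: "nat \<Rightarrow> 'm" and n where v: "v ` {i. i < n} = S"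
    using finite_imp_nat_seg_image_inj_on[OF S(1)] by metis
  define e where "e x = (\<lambda>k. c x (v k))" for x
  have inj: "inj_on e (carrier M)"
  proof (rule inj_onI)
    fix x y assume xy: "x \<in> carrier M" "y \<in> carrier M" "e x = e y"
    have eq: "c x s = c y s" if "s \<in> S" for s
      using that v xy(3) unfolding e_def by (metis imageE)
    have "(\<Oplus>\<^bsub>M\<^esub>s\<in>S. c x s \<odot>\<^bsub>M\<^esub> s) = (\<Oplus>\<^bsub>M\<^esub>s\<in>S. c y s \<odot>\<^bsub>M\<^esub> s)"
      using eq c(1)[OF xy(2)] S(2) by (intro M.finsum_cong') auto
    then show "x = y" using c(2)[OF xy(1)] c(2)[OF xy(2)] by simp
  qed
  define e' where "e' = the_inv_into (carrier M) e"
  have e'e [simp]: "e' (e x) = x" if "x \<in> carrier M" for x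
    using the_inv_into_f_f[OF inj that] unfolding e'_def .
  define M' :: "('a, nat \<Rightarrow> 'a) module" where
    "M' = \<lparr>carrier = e ` carrier M, mult = (\<lambda>x y. x), one = e \<zero>\<^bsub>M\<^esub>, zero = e \<zero>\<^bsub>M\<^esub>,
       add = (\<lambda>x y. e (e' x \<oplus>\<^bsub>M\<^esub> e' y)), smult = (\<lambda>a x. e (a \<odot>\<^bsub>M\<^esub> e' x))\<rparr>"
  have carr: "carrier M' = e ` carrier M" by (simp add: M'_def)
  have e_in: "e x \<in> carrier M'" if "x \<in> carrier M" for x using that by (simp add: carr)
  have M': "left_module R M'"
  proof (intro left_module.intro left_module_axioms.intro)
    show "ring R" by (rule R.ring_axioms)
    show "abelian_group M'"
    proof (rule abelian_groupI)
      fix x assume "x \<in> carrier M'"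
      then obtain u where "u \<in> carrier M" "x = e u" by (auto simp: carr)
      then show "\<exists>y\<in>carrier M'. y \<oplus>\<^bsub>M'\<^esub> x = \<zero>\<^bsub>M'\<^esub>"
        by (intro bexI[of _ "e (\<ominus>\<^bsub>M\<^esub> u)"]) (auto simp: M'_def M.l_neg)
    qed (auto simp: M'_def M.a_ac)
  qed (auto simp: M'_def smult_l_distr smult_r_distr smult_assoc)
  interpret N: left_module R M' by fact
  define i where "i = restrict e (carrier M)"
  define j where "j = restrict e' (carrier M')"
  have i: "i \<in> module_homs R M M'"
    by (auto simp: i_def module_homs_def M'_def)
  have j: "j \<in> module_homs R M' M"
    by (auto simp: j_def module_homs_def M'_def)
  have zero: "e \<zero>\<^bsub>M\<^esub> = \<zero>\<^bsub>M'\<^esub>" by (simp add: M'_def)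
  have sum: "e (\<Oplus>\<^bsub>M\<^esub>s\<in>A. d s \<odot>\<^bsub>M\<^esub> s) = (\<Oplus>\<^bsub>M'\<^esub>t\<in>e ` A. d (e' t) \<odot>\<^bsub>M'\<^esub> t)"
    if "finite A" "A \<subseteq> carrier M" "d \<in> A \<rightarrow> carrier R" for A d
    using that
  proof (induction A)
    case empty
    then show ?case by (simp add: zero)
  next
    case (insert s A)
    have nin: "e s \<notin> e ` A"
      using insert.hyps insert.prems inj by (auto simp: inj_on_def)
    have ds: "d s \<in> carrier R" "s \<in> carrier M" and dA: "d \<in> A \<rightarrow> carrier R" "A \<subseteq> carrier M"
      using insert.prems by auto
    have sumA: "(\<Oplus>\<^bsub>M\<^esub>s\<in>A. d s \<odot>\<^bsub>M\<^esub> s) \<in> carrier M"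
      using dA by (intro M.finsum_closed) auto
    have "(\<Oplus>\<^bsub>M'\<^esub>t\<in>e ` insert s A. d (e' t) \<odot>\<^bsub>M'\<^esub> t)
        = d (e' (e s)) \<odot>\<^bsub>M'\<^esub> e s \<oplus>\<^bsub>M'\<^esub> (\<Oplus>\<^bsub>M'\<^esub>t\<in>e ` A. d (e' t) \<odot>\<^bsub>M'\<^esub> t)"
      unfolding image_insert using insert.hyps nin ds dA
      by (intro N.finsum_insert) (auto simp: subset_iff Pi_iff intro!: N.smult_closed e_in)
    also have "\<dots> = d s \<odot>\<^bsub>M'\<^esub> e s \<oplus>\<^bsub>M'\<^esub> e (\<Oplus>\<^bsub>M\<^esub>s\<in>A. d s \<odot>\<^bsub>M\<^esub> s)"
      using insert.IH dA ds by simp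
    also have "\<dots> = e (d s \<odot>\<^bsub>M\<^esub> s \<oplus>\<^bsub>M\<^esub> (\<Oplus>\<^bsub>M\<^esub>s\<in>A. d s \<odot>\<^bsub>M\<^esub> s))"
      using ds sumA by (simp add: M'_def)
    also have "d s \<odot>\<^bsub>M\<^esub> s \<oplus>\<^bsub>M\<^esub> (\<Oplus>\<^bsub>M\<^esub>s\<in>A. d s \<odot>\<^bsub>M\<^esub> s) = (\<Oplus>\<^bsub>M\<^esub>s\<in>insert s A. d s \<odot>\<^bsub>M\<^esub> s)"
      using insert.hyps ds dA by (subst M.finsum_insert) auto
    finally show ?case by simp
  qed
  have "finitely_generated R M'"
    unfolding finitely_generated_def
  proof (intro exI conjI ballI)
    show "finite (e ` S)" "e ` S \<subseteq> carrier M'" using S by (auto simp: carr)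
    fix y assume "y \<in> carrier M'"
    then obtain x where x: "x \<in> carrier M" "y = e x" by (auto simp: carr)
    show "\<exists>d\<in>e ` S \<rightarrow> carrier R. y = (\<Oplus>\<^bsub>M'\<^esub>s\<in>e ` S. d s \<odot>\<^bsub>M'\<^esub> s)"
    proof (rule bexI)
      show "y = (\<Oplus>\<^bsub>M'\<^esub>t\<in>e ` S. c x (e' t) \<odot>\<^bsub>M'\<^esub> t)"
        using sum[OF S c(1)[OF x(1)]] c(2)[OF x(1)] x(2) by simp
      show "(\<lambda>t. c x (e' t)) \<in> e ` S \<rightarrow> carrier R"
        using c(1)[OF x(1)] S(2) by (auto simp: Pi_iff subset_iff)
    qed
  qed
  then have "M' \<in> Ob (mod_cat R)" using M' by (simp add: mod_cat_def)
  moreover have "j (i x) = x" if "x \<in> carrier M" for x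
    using that by (simp add: i_def j_def carr)
  moreover have "i (j y) = y" if "y \<in> carrier M'" for y
    using that by (auto simp: i_def j_def carr)
  ultimately show ?thesis
    using that i j by blast
qed

lemma projective_module_lift:
  fixes R :: "('a, 'b) ring_scheme"
  assumes P: "projective_module R P"
    and B: "left_module R B" "finitely_generated R B"
    and C: "left_module R C" "finitely_generated R C"
    and p: "p \<in> module_homs R B C" "p ` carrier B = carrier C" and f: "f \<in> module_homs R P C"
  obtains t where "t \<in> module_homs R P B" "compose (carrier P) p t = f"
proof -
  have PP: "left_module R P" using P by (simp add: projective_module_def)
  obtain B' :: "('a, nat \<Rightarrow> 'a) module" and i j where B': "B' \<in> Ob (mod_cat R)"
    "i \<in> module_homs R B B'" "j \<in> module_homs R B' B"
    "\<And>x. x \<in> carrier B \<Longrightarrow> j (i x) = x" "\<And>y. y \<in> carrier B' \<Longrightarrow> i (j y) = y"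
    using finitely_generated_copy[OF B] by metis
  obtain C' :: "('a, nat \<Rightarrow> 'a) module" and k l where C': "C' \<in> Ob (mod_cat R)"
    "k \<in> module_homs R C C'" "l \<in> module_homs R C' C"
    "\<And>x. x \<in> carrier C \<Longrightarrow> l (k x) = x" "\<And>y. y \<in> carrier C' \<Longrightarrow> k (l y) = y"
    using finitely_generated_copy[OF C] by metis
  have LB': "left_module R B'" using B'(1) by (simp add: mod_cat_def)
  have maps: "\<And>x. x \<in> carrier B \<Longrightarrow> i x \<in> carrier B'" "\<And>x. x \<in> carrier B' \<Longrightarrow> j x \<in> carrier B"
    "\<And>x. x \<in> carrier C \<Longrightarrow> k x \<in> carrier C'" "\<And>x. x \<in> carrier C' \<Longrightarrow> l x \<in> carrier C"
    "\<And>x. x \<in> carrier B \<Longrightarrow> p x \<in> carrier C" "\<And>x. x \<in> carrier P \<Longrightarrow> f x \<in> carrier C"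
    using B' C' p f by (auto simp: module_homs_def)
  define q where "q = compose (carrier B') k (compose (carrier B') p j)"
  have q: "q \<in> module_homs R B' C'"
    unfolding q_def using B' C' p LB' by (intro module_homs_compose)
  have surj: "q ` carrier B' = carrier C'"
  proof
    show "q ` carrier B' \<subseteq> carrier C'" using q by (auto simp: module_homs_def)
    show "carrier C' \<subseteq> q ` carrier B'"
    proof
      fix y assume y: "y \<in> carrier C'"
      then obtain x where x: "x \<in> carrier B" "p x = l y" using maps p(2) by (metis imageE)
      then have "q (i x) = y" using y maps B'(4) C'(5) by (simp add: q_def compose_def)
      then show "y \<in> q ` carrier B'" using x maps by blast
    qed
  qed
  have kf: "compose (carrier P) k f \<in> module_homs R P C'"
    using f C' PP by (intro module_homs_compose)
  obtain t where t: "t \<in> module_homs R P B'" "compose (carrier P) q t = compose (carrier P) k f"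
    using P B'(1) C'(1) q surj kf unfolding projective_module_def by blast
  have tm: "\<And>x. x \<in> carrier P \<Longrightarrow> t x \<in> carrier B'" using t(1) by (auto simp: module_homs_def)
  have "p (j (t x)) = f x" if x: "x \<in> carrier P" for x
  proof -
    have "k (p (j (t x))) = k (f x)"
      using fun_cong[OF t(2), of x] x tm by (simp add: compose_def q_def)
    then show ?thesis using C'(4) maps tm x by metis
  qed
  then have "compose (carrier P) p (compose (carrier P) j t) = f"
    using f by (auto simp: compose_def module_homs_def PiE_def extensional_def)
  moreover have "compose (carrier P) j t \<in> module_homs R P B"
    using t(1) B'(3) PP by (intro module_homs_compose)
  ultimately show ?thesis using that by blast
qed


section \<open>Artin algebras\<close>

locale artinian_ring = cring +
  assumes descending_chain:
    "\<lbrakk>\<And>n :: nat. ideal (I n) R; \<And>n. I (Suc n) \<subseteq> I n\<rbrakk> \<Longrightarrow> \<exists>n. \<forall>m\<ge>n. I m = I n"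

text \<open>An algebra over a commutative artinian ring \<open>k\<close> that is finitely generated as a \<open>k\<close>-module.
  The ring operations and the \<open>k\<close>-action are both components of \<open>A\<close>. The locale \<^locale>\<open>algebra\<close>
  does not apply because it requires \<open>A\<close> to be commutative.\<close>

locale artin_algebra = K?: artinian_ring k + module k A + A?: ring A
  for k (structure) and A (structure) +
  assumes smult_mult_left:
      "\<lbrakk>r \<in> carrier k; x \<in> carrier A; y \<in> carrier A\<rbrakk>
        \<Longrightarrow> r \<odot>\<^bsub>A\<^esub> (x \<otimes>\<^bsub>A\<^esub> y) = (r \<odot>\<^bsub>A\<^esub> x) \<otimes>\<^bsub>A\<^esub> y"
    and smult_mult_right:
      "\<lbrakk>r \<in> carrier k; x \<in> carrier A; y \<in> carrier A\<rbrakk>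
        \<Longrightarrow> r \<odot>\<^bsub>A\<^esub> (x \<otimes>\<^bsub>A\<^esub> y) = x \<otimes>\<^bsub>A\<^esub> (r \<odot>\<^bsub>A\<^esub> y)"
    and fin_gen: "finitely_generated k A"


section \<open>The morphism category of \<open>mod-\<Lambda>\<close>\<close>

definition H_cat ::
    "('a, 'b) ring_scheme \<Rightarrow> (('a, 'm) module \<times> ('a, 'm) module \<times> ('m \<Rightarrow> 'm), ('m \<Rightarrow> 'm) \<times> ('m \<Rightarrow> 'm)) cat"
  where
  "H_cat R = morphism_cat (mod_cat R)"

definition P_obj :: "('a, 'b) ring_scheme \<Rightarrow> (('a, 'm) module \<times> ('a, 'm) module \<times> ('m \<Rightarrow> 'm)) set" where
  "P_obj R = {(P, Q, f) \<in> Ob (H_cat R). P \<in> prj R \<and> Q \<in> prj R}"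

end

theory Submission
  imports Defs
begin

text \<open>A morphism out of \<open>g\<close> into \<open>f'\<close> is a pair \<open>(s1, s2)\<close>. Factor \<open>s1 = t \<delta>\<close>; then \<open>f' t\<close> and \<open>s2\<close> agree on
  \<open>N\<close>, so they induce a map \<open>u\<close> on the push-out, and \<open>u = v d\<close> gives the factorisation
  \<open>(t, v)\<close>. This works in any category.\<close>

lemma (in category) left_approximation_morphism_cat:
  assumes g: "(N, M, g) \<in> Ob (morphism_cat C)"
    and \<delta>: "left_approximation C X N Q\<^sub>0 \<delta>"
    and po: "pushout C N Q\<^sub>0 M U \<delta> g h l"
    and d: "left_approximation C X U Q d"
  shows "left_approximation (morphism_cat C) {(P, P', f) \<in> Ob (morphism_cat C). P \<in> X \<and> P' \<in> X}
           (N, M, g) (Q\<^sub>0, Q, Comp C Q\<^sub>0 U Q d h) (\<delta>, Comp C M U Q d l)"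
proof -
  have X: "X \<subseteq> Ob C" and QX: "Q\<^sub>0 \<in> X" "Q \<in> X"
    and \<delta>_in: "\<delta> \<in> Hom C N Q\<^sub>0" and d_in: "d \<in> Hom C U Q"
    using \<delta> d by (auto simp: left_approximation_def)
  have Ob: "N \<in> Ob C" "M \<in> Ob C" "U \<in> Ob C" "Q\<^sub>0 \<in> Ob C" "Q \<in> Ob C"
    and g_in: "g \<in> Hom C N M" and h_in: "h \<in> Hom C Q\<^sub>0 U" and l_in: "l \<in> Hom C M U"
    and comm: "Comp C N Q\<^sub>0 U h \<delta> = Comp C N M U l g"
    using po X QX by (auto simp: pushout_def)
  have dh_in: "Comp C Q\<^sub>0 U Q d h \<in> Hom C Q\<^sub>0 Q" and dl_in: "Comp C M U Q d l \<in> Hom C M Q"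
    using Ob h_in l_in d_in by (auto intro: Comp_in)
  \<comment> \<open>Needed for the pair to be a morphism of \<open>morphism_cat C\<close>: both
    sides reassociate to \<open>d\<close> after the common diagonal of the push-out square.\<close>
  have square: "Comp C N M Q (Comp C M U Q d l) g = Comp C N Q\<^sub>0 Q (Comp C Q\<^sub>0 U Q d h) \<delta>"
    using Ob comm Comp_assoc[of N M U Q g l d] Comp_assoc[of N Q\<^sub>0 U Q \<delta> h d]
      g_in l_in h_in \<delta>_in d_in by simp
  \<comment> \<open>The factorisation property in components; the first equation says that
    \<open>(t, v)\<close> is itself a morphism of \<open>morphism_cat C\<close>.\<close>
  have factor: "\<exists>t v. t \<in> Hom C Q\<^sub>0 P \<and> v \<in> Hom C Q P' \<and>
      Comp C Q\<^sub>0 Q P' v (Comp C Q\<^sub>0 U Q d h) = Comp C Q\<^sub>0 P P' f t \<and>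
      Comp C N Q\<^sub>0 P t \<delta> = s1 \<and> Comp C M Q P' v (Comp C M U Q d l) = s2"
    if P: "P \<in> X" "P' \<in> X" and f: "f \<in> Hom C P P'"
      and s: "s1 \<in> Hom C N P" "s2 \<in> Hom C M P'" "Comp C N M P' s2 g = Comp C N P P' f s1"
    for P P' f s1 s2
  proof -
    have POb: "P \<in> Ob C" "P' \<in> Ob C" using P X by auto
    obtain t where t: "t \<in> Hom C Q\<^sub>0 P" "Comp C N Q\<^sub>0 P t \<delta> = s1"
      using \<delta> P(1) s(1) unfolding left_approximation_def by blast
    have ft: "Comp C Q\<^sub>0 P P' f t \<in> Hom C Q\<^sub>0 P'"
      using Ob POb t(1) f by (intro Comp_in)
    \<comment> \<open>The agreement on \<open>N\<close> comes from the commuting square of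
      \<open>(s1, s2)\<close>: \<open>(f t) \<delta> = f s1 = s2 g\<close>.\<close>
    have "Comp C N Q\<^sub>0 P' (Comp C Q\<^sub>0 P P' f t) \<delta> = Comp C N M P' s2 g"
      using Comp_assoc[of N Q\<^sub>0 P P' \<delta> t f] Ob POb \<delta>_in t f s(3) by simp
    then obtain u where u: "u \<in> Hom C U P'"
      "Comp C Q\<^sub>0 U P' u h = Comp C Q\<^sub>0 P P' f t" "Comp C M U P' u l = s2"
      using po POb(2) ft s(2) unfolding pushout_def by blast
    obtain v where v: "v \<in> Hom C Q P'" "Comp C U Q P' v d = u"
      using d P(2) u(1) unfolding left_approximation_def by blast
    \<comment> \<open>Reassociation and \<open>v d = u\<close> turn \<open>v (d h)\<close> into
      \<open>u h = f t\<close> and \<open>v (d l)\<close> into \<open>u l = s2\<close>.\<close>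
    have "Comp C Q\<^sub>0 Q P' v (Comp C Q\<^sub>0 U Q d h) = Comp C Q\<^sub>0 P P' f t"
      "Comp C M Q P' v (Comp C M U Q d l) = s2"
      using Comp_assoc[of Q\<^sub>0 U Q P' h d v] Comp_assoc[of M U Q P' l d v]
        Ob POb h_in l_in d_in u v by simp_all
    then show ?thesis using t v(1) by blast
  qed
  show ?thesis
    unfolding left_approximation_def
  proof (intro conjI ballI)
    fix x' f' assume "x' \<in> {(P, P', f) \<in> Ob (morphism_cat C). P \<in> X \<and> P' \<in> X}"
      "f' \<in> Hom (morphism_cat C) (N, M, g) x'"
    then obtain P P' f s1 s2 where [simp]: "x' = (P, P', f)" "f' = (s1, s2)"
      and *: "P \<in> X" "P' \<in> X" "f \<in> Hom C P P'" "s1 \<in> Hom C N P" "s2 \<in> Hom C M P'"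
        "Comp C N M P' s2 g = Comp C N P P' f s1"
      by (auto simp: morphism_cat_def)
    \<comment> \<open>The bound \<open>t\<close> is now a pair; its witness is \<open>(t, v)\<close>
      from \<open>factor\<close>.\<close>
    show "\<exists>t\<in>Hom (morphism_cat C) (Q\<^sub>0, Q, Comp C Q\<^sub>0 U Q d h) x'.
        Comp (morphism_cat C) (N, M, g) (Q\<^sub>0, Q, Comp C Q\<^sub>0 U Q d h) x' t (\<delta>, Comp C M U Q d l) = f'"
      using factor[OF *] by (fastforce simp: morphism_cat_def)
  \<comment> \<open>What remains is that source and target are objects of the right kind and, by
    \<open>square\<close>, that the given pair is a morphism between them.\<close>
  qed (use g QX Ob \<delta>_in dh_in dl_in square in \<open>auto simp: morphism_cat_def\<close>)
qed

text \<open>The general lemma for \<open>C = mod_cat \<Lambda>\<close> and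
  \<open>X = prj \<Lambda>\<close>: unfolding \<open>P_obj\<close> and \<open>H_cat\<close> gives
  exactly the subcategory in its conclusion.\<close>

theorem proposition3p9:
  fixes k :: "('k, 'c) ring_scheme"
    and \<Lambda> :: "('k, 'a, 'd) module_scheme"
    and N M Q\<^sub>0 U Q :: "('a, 'm) module"
    and g \<delta> h l d :: "'m \<Rightarrow> 'm"
  assumes "artin_algebra k \<Lambda>"
    and "(N, M, g) \<in> Ob (H_cat \<Lambda>)"
    and "left_approximation (mod_cat \<Lambda>) (prj \<Lambda>) N Q\<^sub>0 \<delta>"
    and "pushout (mod_cat \<Lambda>) N Q\<^sub>0 M U \<delta> g h l"
    and "left_approximation (mod_cat \<Lambda>) (prj \<Lambda>) U Q d"
  shows "left_approximation (H_cat \<Lambda>) (P_obj \<Lambda>)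
           (N, M, g)
           (Q\<^sub>0, Q, Comp (mod_cat \<Lambda>) Q\<^sub>0 U Q d h)
           (\<delta>, Comp (mod_cat \<Lambda>) M U Q d l)"
  using category.left_approximation_morphism_cat[OF category_mod_cat
      assms(2)[unfolded H_cat_def] assms(3-5)]
  unfolding P_obj_def H_cat_def .

end
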